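(* There is $\omega_0\in(0,m)$ and an open neighborhood $U\subset\mathbb{R}$ of $0$ such that for $\omega\in(\omega_0,m)$ and $\epsilon\in U$ the operator $\mathbf{A}(\epsilon)$ (defined in the context; it depends on $\omega$) has two eigenvalues $$\lambda(\epsilon)=\pm i(2\omega+\zeta(\epsilon)),\qquad\zeta(\epsilon)\in\mathbb{R}\quad\forall\epsilon\in U,\qquad\lim_{\epsilon\to0}\zeta(\epsilon)=0.$$
   Context: Let $m>0$, and let $f\in C(\mathbb{R})\cap C^1(\mathbb{R}\setminus\{0\})$ be real-valued with $f(0)=0$. Pauli matrices: $\sigma_1=\begin{bmatrix}0&1\\1&0\end{bmatrix}$, $\sigma_2=\begin{bmatrix}0&-i\\i&0\end{bmatrix}$, $\sigma_3=\begin{bmatrix}1&0\\0&-1\end{bmatrix}$; $\Pi_1=\begin{bmatrix}1&0\\0&0\end{bmatrix}$; $I_2$ is the identity. $D_m=i\sigma_2\partial_x+m\sigma_3$. For $\omega\in(-m,m)$ put $\varkappa=\sqrt{m^2-\omega^2}$ and $\mu=\mu(\omega)=\sqrt{\frac{m-\omega}{m+\omega}}$. For a vector function $\psi\in H^1(\mathbb{R}\setminus\{0\})$ write $\hat\psi=(\psi(0^+)+\psi(0^-))/2$, $[\psi]_0=\psi(0^+)-\psi(0^-)$. Consider the perturbed equation $i\partial_t\psi=D_m\psi-\delta(x)f(\psi^*(\sigma_3+\epsilon I_2)\psi)(\sigma_3+\epsilon I_2)\psi$, $\psi(t,x)\in\mathbb{C}^2$, understood with the jump condition $i\sigma_2[\psi]_0=f(\hat\psi^*(\sigma_3+\epsilon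 I_2)\hat\psi)(\sigma_3+\epsilon I_2)\hat\psi$. It has solitary waves $\phi_{\omega,\epsilon}(x)e^{-i\omega t}$ with $\phi_{\omega,\epsilon}(x)=\alpha\begin{bmatrix}1\\\mu\,\mathrm{sgn}\,x\end{bmatrix}e^{-\varkappa|x|}$, where $\alpha=\alpha(\omega,\epsilon)>0$ satisfies $2\mu(\omega)=(1+\epsilon)f(\tau)$, $\tau=(1+\epsilon)\alpha^2$; the existence of such $\alpha(\omega,\epsilon)$ for the values of $\omega,\epsilon$ under consideration is understood. Write below $f=f(\tau)$, $g=f'(\tau)$ for the values at this $\tau$. The linearization operator $\mathbf{A}(\epsilon)$ at this solitary wave (from $\psi=(\phi_{\omega,\epsilon}+r+is)e^{-i\omega t}$) is the unbounded operator in $L^2(\mathbb{R},\mathbb{C}^4)$ acting on $(r,s)$ as $\begin{bmatrix}0&D_m-\omega I_2\\-D_m+\omega I_2&0\end{bmatrix}$ on $\mathbb{R}\setminus\{0\}$, with domain consisting of $(r,s)\in H^1(\mathbb{R}\setminus\{0\},\mathbb{C}^2\times\mathbb{C}^2)$ such that $$i\sigma_2[r]_0-\big(f(\sigma_3+\epsilon I_2)+2(1+\epsilon)^2g\alpha^2\Pi_1\big)\hat r=0,\qquad i\sigma_2[s]_0-f(\sigma_3+\epsilon I_2)\hat s=0.$$ *)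

theory Defs
  imports "HOL-Analysis.Analysis"
begin

definition sigma2 :: "complex^2^2" where
  "sigma2 = vector [vector [0, - \<i>], vector [\<i>, 0]]"

definition sigma3 :: "complex^2^2" where
  "sigma3 = vector [vector [1, 0], vector [0, -1]]"

definition Pi1 :: "complex^2^2" where
  "Pi1 = vector [vector [1, 0], vector [0, 0]]"

definition mu :: "real \<Rightarrow> real \<Rightarrow> real" where
  "mu m \<omega> = sqrt ((m - \<omega>) / (m + \<omega>))"

text \<open>
  Elements of \<open>L\<^sup>2\<close> are handled through representatives \<open>real \<Rightarrow> complex^2\<close>; every notion
  below is invariant under changing a representative on a null set.
\<close>

type_synonym spinor = "real \<Rightarrow> complex^2"

definition L2 :: "spinor set" where
  "L2 = {u. u \<in> borel_measurable lborel \<and> integrable lborel (\<lambda>x. (norm (u x))\<^sup>2)}"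

definition test_function :: "real set \<Rightarrow> (real \<Rightarrow> real) \<Rightarrow> bool" where
  "test_function S \<phi> \<longleftrightarrow>
     (\<forall>n x. ((deriv ^^ n) \<phi>) differentiable (at x)) \<and>
     (\<exists>K. compact K \<and> K \<subseteq> S \<and> (\<forall>x. x \<notin> K \<longrightarrow> \<phi> x = 0))"

text \<open>
  Distributional derivative on \<open>\<real> \<setminus> {0}\<close>: the test functions vanish near \<open>0\<close>, so jumps
  of \<open>u\<close> at \<open>0\<close> do not contribute.
\<close>

definition weak_derivative :: "spinor \<Rightarrow> spinor \<Rightarrow> bool" where
  "weak_derivative u v \<longleftrightarrow>
     (\<forall>\<phi>. test_function (- {0}) \<phi> \<longrightarrow>
        (LINT x|lborel. deriv \<phi> x *\<^sub>R u x) = - (LINT x|lborel. \<phi> x *\<^sub>R v x))"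

definition H1 :: "spinor set" where
  "H1 = {u \<in> L2. \<exists>v\<in>L2. weak_derivative u v}"

text \<open>
  One-sided values at \<open>0\<close>, namely the limit along the filter \<open>F\<close> (\<open>at_right 0\<close> or
  \<open>at_left 0\<close>) of the representative that is continuous on \<open>\<real> \<setminus> {0}\<close>. For \<open>u \<in> H1\<close> this
  representative and its one-sided limits exist and are unique.
\<close>

definition trace_zero :: "real filter \<Rightarrow> spinor \<Rightarrow> complex^2" where
  "trace_zero F u = (THE l. \<exists>w. continuous_on (- {0}) w \<and> (AE x in lborel. w x = u x) \<and> (w \<longlongrightarrow> l) F)"

definition jump :: "spinor \<Rightarrow> complex^2" where
  "jump u = trace_zero (at_right 0) u - trace_zero (at_left 0) u"

definition mean :: "spinor \<Rightarrow> complex^2" where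
  "mean u = (1/2) *\<^sub>R (trace_zero (at_right 0) u + trace_zero (at_left 0) u)"

text \<open>\<open>dirac m u' u\<close> is \<open>D\<^sub>m u\<close>, where \<open>u'\<close> stands for \<open>\<partial>\<^sub>x u\<close>.\<close>

definition dirac :: "real \<Rightarrow> spinor \<Rightarrow> spinor \<Rightarrow> spinor" where
  "dirac m u' u = (\<lambda>x. \<i> *s (sigma2 *v u' x) + m *\<^sub>R (sigma3 *v u x))"

definition linearization_domain ::
    "(real \<Rightarrow> real) \<Rightarrow> real \<Rightarrow> real \<Rightarrow> (spinor \<times> spinor) set" where
  "linearization_domain f \<epsilon> \<alpha> =
     (let \<tau> = (1 + \<epsilon>) * \<alpha>\<^sup>2; g = deriv f \<tau>; S = sigma3 + \<epsilon> *\<^sub>R mat 1 in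
      {(r, s). r \<in> H1 \<and> s \<in> H1 \<and>
         \<i> *s (sigma2 *v jump r)
           - (f \<tau> *\<^sub>R S + (2 * (1 + \<epsilon>)\<^sup>2 * g * \<alpha>\<^sup>2) *\<^sub>R Pi1) *v mean r = 0 \<and>
         \<i> *s (sigma2 *v jump s) - (f \<tau> *\<^sub>R S) *v mean s = 0})"

text \<open>
  The unbounded operator is represented by its graph, the set of pairs
  \<open>((r, s), \<A> (r, s))\<close>. As weak derivatives are unique up to null sets, the second
  component is determined almost everywhere by the first.
\<close>

definition linearization ::
    "real \<Rightarrow> (real \<Rightarrow> real) \<Rightarrow> real \<Rightarrow> real \<Rightarrow> real \<Rightarrow> ((spinor \<times> spinor) \<times> (spinor \<times> spinor)) set" where
  "linearization m f \<omega> \<epsilon> \<alpha> =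
     {((r, s), (p, q)).
        (r, s) \<in> linearization_domain f \<epsilon> \<alpha> \<and> p \<in> L2 \<and> q \<in> L2 \<and>
        (\<exists>r'\<in>L2. \<exists>s'\<in>L2. weak_derivative r r' \<and> weak_derivative s s' \<and>
           (AE x in lborel. p x = dirac m s' s x - \<omega> *\<^sub>R s x) \<and>
           (AE x in lborel. q x = - dirac m r' r x + \<omega> *\<^sub>R r x))}"

definition eigenvalue :: "((spinor \<times> spinor) \<times> (spinor \<times> spinor)) set \<Rightarrow> complex \<Rightarrow> bool" where
  "eigenvalue A z \<longleftrightarrow>
     (\<exists>r s. ((r, s), (\<lambda>x. z *s r x, \<lambda>x. z *s s x)) \<in> A \<and>
        \<not> (AE x in lborel. r x = 0 \<and> s x = 0))"

end

theory Submission
  imports Defs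
begin

text \<open>
  The operator preserves the parity class (odd, even). In it the mean of \<open>r\<close> has zero first
  component, so the \<open>\<Pi>\<^sub>1\<close> term of the jump condition drops out, \<open>r\<close> and \<open>s\<close> satisfy the same
  condition, and \<open>(r, s) = (w, c w)\<close> with \<open>c = \<plusminus>\<i>\<close> decouples the system into \<open>D\<^sub>m w = - W w\<close> with
  \<open>\<lambda> = \<mp>\<i> (\<omega> + W)\<close>. The odd-even bound state at energy \<open>- W\<close> satisfies the jump condition
  iff \<open>2 \<mu>(W) = (1 - \<epsilon>) f(\<tau>)\<close>, that is, \<open>\<mu>(W) = \<mu>(\<omega>) (1 - \<epsilon>) / (1 + \<epsilon>)\<close>; solving for \<open>W\<close>
  gives \<open>\<zeta> = W - \<omega>\<close> explicitly.
\<close>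

section \<open>Weak derivatives and traces\<close>

text \<open>The support \<open>K\<close> of the test function avoids 0, so \<open>\<phi> u\<close>
  is C^1 on the whole line with compact support, and its derivative integrates to zero by the
  fundamental theorem of calculus.\<close>

lemma weak_derivative_C1:
  assumes deriv: "\<And>x. x \<noteq> 0 \<Longrightarrow> (u has_vector_derivative v x) (at x)"
    and cont: "continuous_on (- {0}) v"
  shows "weak_derivative u v"
  unfolding weak_derivative_def
proof (intro allI impI)
  fix \<phi> assume \<phi>: "test_function (- {0}) \<phi>"
  have diff: "((deriv ^^ n) \<phi>) differentiable (at x)" for n x
    using \<phi> by (auto simp: test_function_def)
  obtain K where K: "compact K" "K \<subseteq> - {0}" "\<And>x. x \<notin> K \<Longrightarrow> \<phi> x = 0"
    using \<phi> by (auto simp: test_function_def)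
  have d\<phi>: "(\<phi> has_real_derivative deriv \<phi> x) (at x)" for x
    using diff[of 0 x] by (simp add: DERIV_deriv_iff_real_differentiable)
  have cont_\<phi>: "continuous_on A (deriv \<phi>)" "continuous_on A \<phi>" for A
    using diff[of 1] diff[of 0]
    by (simp_all add: differentiable_imp_continuous_within continuous_at_imp_continuous_on)
  have open_K: "open (- K)"
    using K(1) by (simp add: compact_imp_closed open_Compl)
  have d\<phi>0: "deriv \<phi> x = 0" if "x \<notin> K" for x
  proof -
    have "((\<lambda>_. 0) has_real_derivative deriv \<phi> x) (at x)"
      by (rule has_field_derivative_transform_within_open[OF d\<phi> open_K]) (use that K in auto)
    then show ?thesis
      by (rule DERIV_unique) simp
  qed
  have cont_u: "continuous_on (- {0}) u"
    using deriv by (intro continuous_at_imp_continuous_on) (auto intro: has_vector_derivative_continuous)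
  \<comment> \<open>Product-rule derivative of \<open>\<phi> u\<close>. The arbitrary values
    \<open>u 0\<close> and \<open>v 0\<close> are harmless, since \<open>\<phi>\<close> and its
    derivative vanish off \<open>K\<close>, in particular at 0.\<close>
  define G where "G = (\<lambda>x. deriv \<phi> x *\<^sub>R u x + \<phi> x *\<^sub>R v x)"
  have dF: "((\<lambda>x. \<phi> x *\<^sub>R u x) has_vector_derivative G x) (at x)" for x
  proof (cases "x \<in> K")
    case True
    then have "x \<noteq> 0" using K by auto
    have "((\<lambda>x. \<phi> x *\<^sub>R u x) has_vector_derivative \<phi> x *\<^sub>R v x + deriv \<phi> x *\<^sub>R u x) (at x)"
      by (rule has_vector_derivative_scaleR[OF d\<phi> deriv[OF \<open>x \<noteq> 0\<close>]])
    then show ?thesis by (simp add: G_def add.commute)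
  next
    case False
    have "((\<lambda>_. 0) has_vector_derivative G x) (at x)"
      using False K by (simp add: G_def d\<phi>0)
    then show ?thesis
      by (rule has_vector_derivative_transform_within_open[OF _ open_K]) (use False K in auto)
  qed
  have G0: "G x = 0" if "x \<notin> K" for x
    using that K by (simp add: G_def d\<phi>0)
  \<comment> \<open>These two open sets cover the line because \<open>K\<close> avoids 0; on the
    second one \<open>G\<close> is identically zero.\<close>
  have "continuous_on (- {0} \<union> - K) G"
  proof (rule continuous_on_open_Un[OF _ open_K])
    show "continuous_on (- {0}) G"
      unfolding G_def by (intro continuous_intros cont_\<phi> cont_u cont)
    show "continuous_on (- K) G"
      using G0 by (subst continuous_on_cong[OF refl, of _ _ "\<lambda>_. 0"]) auto
  qed auto
  then have cont_G: "continuous_on UNIV G"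
    using K by (metis Compl_Int Compl_subset_Compl_iff compl_bot_eq disjoint_eq_subset_Compl
        double_complement inf.absorb_iff2 inf_commute)
  \<comment> \<open>The bound is strict, so the endpoints lie outside \<open>K\<close> and the
    boundary terms vanish.\<close>
  obtain N where N: "\<And>x. x \<in> K \<Longrightarrow> \<bar>x\<bar> < N" "N > 0"
    using compact_imp_bounded[OF K(1)] by (force simp: bounded_pos_less)
  have "integral\<^sup>L lborel (\<lambda>x. indicator {-N..N} x *\<^sub>R G x) = \<phi> N *\<^sub>R u N - \<phi> (-N) *\<^sub>R u (-N)"
    using N(2)
    by (intro integral_FTC_atLeastAtMost has_vector_derivative_at_within[OF dF]
        continuous_on_subset[OF cont_G]) auto
  moreover have "N \<notin> K" "- N \<notin> K"
    using N by force+
  moreover have "(\<lambda>x. indicator {-N..N} x *\<^sub>R G x) = G"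
  proof
    fix x show "indicator {-N..N} x *\<^sub>R G x = G x"
      using N(1)[of x] G0[of x] by (cases "x \<in> K") (auto simp: indicator_def)
  qed
  ultimately have "integral\<^sup>L lborel G = 0"
    using K(3) by simp
  \<comment> \<open>Splitting the integral of \<open>G\<close> requires each summand to be
    integrable: both are continuous on \<open>K\<close> and zero elsewhere.\<close>
  moreover have "integrable lborel (\<lambda>x. indicator K x *\<^sub>R (deriv \<phi> x *\<^sub>R u x))"
    using K(2) by (intro borel_integrable_compact K(1) continuous_intros cont_\<phi> continuous_on_subset[OF cont_u])
  then have "integrable lborel (\<lambda>x. deriv \<phi> x *\<^sub>R u x)"
    by (rule back_subst[of "integrable lborel"]) (use d\<phi>0 in \<open>force simp: fun_eq_iff indicator_def\<close>)
  moreover have "integrable lborel (\<lambda>x. indicator K x *\<^sub>R (\<phi> x *\<^sub>R v x))"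
    using K(2) by (intro borel_integrable_compact K(1) continuous_intros cont_\<phi> continuous_on_subset[OF cont])
  then have "integrable lborel (\<lambda>x. \<phi> x *\<^sub>R v x)"
    by (rule back_subst[of "integrable lborel"]) (use K(3) in \<open>force simp: fun_eq_iff indicator_def\<close>)
  ultimately show "(LINT x|lborel. deriv \<phi> x *\<^sub>R u x) = - (LINT x|lborel. \<phi> x *\<^sub>R v x)"
    by (simp add: G_def eq_neg_iff_add_eq_0)
qed

text \<open>The points of \<open>S\<close> where the functions differ form an open null set, and
  such a set is empty.\<close>

lemma continuous_AE_eq_imp_eq:
  fixes u v :: "'a::euclidean_space \<Rightarrow> 'b::real_normed_vector"
  assumes "open S" "continuous_on S u" "continuous_on S v" "AE x in lborel. u x = v x" "x \<in> S"
  shows "u x = v x"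
proof (rule ccontr)
  assume "u x \<noteq> v x"
  let ?T = "S \<inter> (\<lambda>x. u x - v x) -` (- {0})"
  have "open ?T"
    by (rule continuous_open_preimage) (use assms in \<open>auto intro: continuous_intros\<close>)
  moreover have "AE x \<in> ?T in lebesgue. x \<in> {}"
    by (rule AE_completion) (use assms(4) in auto)
  moreover have "x \<in> ?T"
    using assms \<open>u x \<noteq> v x\<close> by auto
  ultimately show False
    using mem_closed_if_AE_lebesgue_open[of ?T "{}" x] by auto
qed

text \<open>Discharges the definite description: any other continuous representative agrees with
  \<open>u\<close> everywhere off 0, and limits along the nontrivial filter \<open>F\<close> are
  unique.\<close>

lemma trace_zero_eqI:
  assumes cont: "continuous_on (- {0}) u" and lim: "(u \<longlongrightarrow> l) F"
    and F: "F = at_right 0 \<or> F = at_left 0"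
  shows "trace_zero F u = l"
  unfolding trace_zero_def
proof (rule the_equality)
  show "\<exists>w. continuous_on (- {0}) w \<and> (AE x in lborel. w x = u x) \<and> (w \<longlongrightarrow> l) F"
    using assms by auto
next
  fix l' assume "\<exists>w. continuous_on (- {0}) w \<and> (AE x in lborel. w x = u x) \<and> (w \<longlongrightarrow> l') F"
  then obtain w where w: "continuous_on (- {0}) w" "AE x in lborel. w x = u x" "(w \<longlongrightarrow> l') F"
    by blast
  have eq: "w x = u x" if "x \<noteq> 0" for x
    by (rule continuous_AE_eq_imp_eq[OF _ w(1) cont w(2)]) (use that in auto)
  have "F \<noteq> bot"
    using F by (metis trivial_limit_at_left_real trivial_limit_at_right_real)
  have "\<forall>\<^sub>F x in F. x \<noteq> 0"
    using F by (auto simp: eventually_at_filter)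
  then have "\<forall>\<^sub>F x in F. w x = u x"
    using eq by (auto elim: eventually_mono)
  then have "(u \<longlongrightarrow> l') F"
    using w(3) tendsto_cong by blast
  then show "l' = l"
    using lim tendsto_unique \<open>F \<noteq> bot\<close> by blast
qed

section \<open>Exponential profiles\<close>

text \<open>Domination by a half-line exponential plus its reflection; the sum counts 0 twice, hence
  a bound instead of an equality.\<close>

lemma integrable_exp_minus_abs:
  fixes c :: real
  assumes "c > 0"
  shows "integrable lborel (\<lambda>x. exp (- c * \<bar>x\<bar>))"
proof -
  define g where "g = (\<lambda>x::real. indicator {0..} x * exp (- c * x))"
  have "(\<integral>\<^sup>+x. ennreal (g x) \<partial>lborel) = ennreal (exp (- c * 0) / c)"
    unfolding g_def
    by (rule nn_integral_has_integral_lebesgue[OF _ has_integral_exp_minus_to_infinity[OF assms]]) auto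
  then have g: "integrable lborel g"
    by (intro integrableI_nonneg) (auto simp: g_def)
  then have "integrable lborel (\<lambda>x. g (- x))"
    using lborel_integrable_real_affine[OF g, of "-1" 0] by simp
  with g have "integrable lborel (\<lambda>x. g x + g (- x))"
    by (rule Bochner_Integration.integrable_add)
  then show ?thesis
    by (rule Bochner_Integration.integrable_bound) (auto simp: g_def indicator_def)
qed

text \<open>\<open>p\<close> is the amplitude of the odd part and \<open>q\<close> that of the even
  part. The jump at 0 sees only \<open>p\<close>, the mean only \<open>q\<close>, and
  differentiation off 0 stays within the family.\<close>

definition profile :: "real \<Rightarrow> complex^2 \<Rightarrow> complex^2 \<Rightarrow> spinor" where
  "profile k p q = (\<lambda>x. exp (- k * \<bar>x\<bar>) *\<^sub>R (sgn x *\<^sub>R p + q))"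

lemma profile_in_L2:
  assumes "k > 0"
  shows "profile k p q \<in> L2"
proof -
  have meas: "profile k p q \<in> borel_measurable lborel"
    unfolding profile_def by measurable
  have "integrable lborel (\<lambda>x. (norm p + norm q)\<^sup>2 * exp (- (2 * k) * \<bar>x\<bar>))"
    using integrable_exp_minus_abs[of "2 * k"] assms by simp
  then have "integrable lborel (\<lambda>x. (norm (profile k p q x))\<^sup>2)"
  proof (rule Bochner_Integration.integrable_bound)
    show "(\<lambda>x. (norm (profile k p q x))\<^sup>2) \<in> borel_measurable lborel"
      using meas by measurable
    show "AE x in lborel. norm ((norm (profile k p q x))\<^sup>2)
        \<le> norm ((norm p + norm q)\<^sup>2 * exp (- (2 * k) * \<bar>x\<bar>))"
    proof (rule AE_I2)
      fix x :: real
      have "norm (sgn x *\<^sub>R p + q) \<le> norm p + norm q"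
        by (rule order_trans[OF norm_triangle_ineq]) (auto simp: sgn_real_def)
      then have "(norm (sgn x *\<^sub>R p + q))\<^sup>2 \<le> (norm p + norm q)\<^sup>2"
        by (rule power_mono) simp
      moreover have "(exp (- k * \<bar>x\<bar>))\<^sup>2 = exp (- (2 * k) * \<bar>x\<bar>)"
        by (simp flip: exp_double add: algebra_simps)
      ultimately show "norm ((norm (profile k p q x))\<^sup>2)
          \<le> norm ((norm p + norm q)\<^sup>2 * exp (- (2 * k) * \<bar>x\<bar>))"
        by (simp add: profile_def power_mult_distrib)
    qed
  qed
  with meas show ?thesis
    by (simp add: L2_def)
qed

lemma continuous_on_sgn_off_0: "continuous_on (- {0}) (sgn :: real \<Rightarrow> real)"
  by (intro continuous_at_imp_continuous_on ballI isCont_sgn) (auto intro: continuous_ident)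

lemma continuous_on_profile: "continuous_on (- {0}) (profile k p q)"
  unfolding profile_def by (intro continuous_intros continuous_on_sgn_off_0)

text \<open>Differentiating the exponential produces the factor \<open>- k * sgn x\<close>; since
  \<open>sgn x\<close> squares to 1 off 0, the odd and even amplitudes swap.\<close>

lemma profile_has_vector_derivative:
  assumes "x \<noteq> 0"
  shows "(profile k p q has_vector_derivative profile k (- k *\<^sub>R q) (- k *\<^sub>R p) x) (at x)"
proof -
  \<comment> \<open>The open half-line containing \<open>x\<close>, on which \<open>sgn\<close> is
    constant and the absolute value is linear.\<close>
  define S where "S = {y. 0 < sgn x * y}"
  have "open S"
    unfolding S_def by (intro open_Collect_less continuous_intros)
  have "x \<in> S"
    using assms by (simp add: S_def sgn_real_def)
  have on_S: "\<bar>y\<bar> = sgn x * y" "sgn y = sgn x" if "y \<in> S" for y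
    using that by (auto simp: S_def sgn_real_def split: if_splits)
  have "((\<lambda>y. exp (- k * (sgn x * y)) *\<^sub>R (sgn x *\<^sub>R p + q)) has_vector_derivative
      (exp (- k * (sgn x * x)) * (- k * sgn x)) *\<^sub>R (sgn x *\<^sub>R p + q)) (at x)"
    by (auto intro!: derivative_eq_intros simp: has_vector_derivative_def)
  also have "(exp (- k * (sgn x * x)) * (- k * sgn x)) *\<^sub>R (sgn x *\<^sub>R p + q)
      = profile k (- k *\<^sub>R q) (- k *\<^sub>R p) x"
    using assms by (auto simp: profile_def on_S[OF \<open>x \<in> S\<close>] sgn_real_def algebra_simps)
  finally show ?thesis
    by (rule has_vector_derivative_transform_within_open[OF _ \<open>open S\<close> \<open>x \<in> S\<close>])
       (simp add: profile_def on_S)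
qed

lemma weak_derivative_profile:
  "weak_derivative (profile k p q) (profile k (- k *\<^sub>R q) (- k *\<^sub>R p))"
  by (rule weak_derivative_C1[OF profile_has_vector_derivative continuous_on_profile])

lemma profile_in_H1: "k > 0 \<Longrightarrow> profile k p q \<in> H1"
  unfolding H1_def using profile_in_L2 weak_derivative_profile by blast

lemma trace_zero_profile_right: "trace_zero (at_right 0) (profile k p q) = p + q"
proof (rule trace_zero_eqI[OF continuous_on_profile])
  have "((\<lambda>x. exp (- k * \<bar>x\<bar>) *\<^sub>R (1 *\<^sub>R p + q)) \<longlongrightarrow> exp (- k * \<bar>0\<bar>) *\<^sub>R (1 *\<^sub>R p + q)) (at_right 0)"
    by (intro tendsto_intros)
  moreover have "\<forall>\<^sub>F x in at_right 0. exp (- k * \<bar>x\<bar>) *\<^sub>R (1 *\<^sub>R p + q) = profile k p q x"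
    by (auto simp: profile_def eventually_at_filter)
  ultimately show "(profile k p q \<longlongrightarrow> p + q) (at_right 0)"
    using tendsto_cong by fastforce
qed simp

lemma trace_zero_profile_left: "trace_zero (at_left 0) (profile k p q) = q - p"
proof (rule trace_zero_eqI[OF continuous_on_profile])
  have "((\<lambda>x. exp (- k * \<bar>x\<bar>) *\<^sub>R (-1 *\<^sub>R p + q)) \<longlongrightarrow> exp (- k * \<bar>0\<bar>) *\<^sub>R (-1 *\<^sub>R p + q)) (at_left 0)"
    by (intro tendsto_intros)
  moreover have "\<forall>\<^sub>F x in at_left 0. exp (- k * \<bar>x\<bar>) *\<^sub>R (-1 *\<^sub>R p + q) = profile k p q x"
    by (auto simp: profile_def eventually_at_filter)
  ultimately show "(profile k p q \<longlongrightarrow> q - p) (at_left 0)"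
    using tendsto_cong by fastforce
qed simp

lemma jump_profile: "jump (profile k p q) = 2 *\<^sub>R p"
  by (simp add: jump_def trace_zero_profile_left trace_zero_profile_right scaleR_2)

lemma mean_profile: "mean (profile k p q) = q"
  by (simp add: mean_def trace_zero_profile_left trace_zero_profile_right flip: scaleR_2)

section \<open>The odd-even bound state\<close>

lemmas spinor_simps = vec_eq_iff forall_2 sum_2 matrix_vector_mult_def sigma2_def sigma3_def
  Pi1_def mat_def

text \<open>\<open>\<nu>\<close> stands for \<open>mu m W\<close>, and \<open>W\<close> is recovered
  by inverting \<open>mu\<close>. The relations \<open>z1\<close> and \<open>z2\<close> are the two
  rows of the eigenvalue equation for the pair \<open>(w, c w)\<close>.\<close>

lemma linearization_eigenvalue:
  fixes c z :: complex
  assumes "m > 0" "\<nu> > 0" and jump_cond: "2 * \<nu> = (1 - \<epsilon>) * f ((1 + \<epsilon>) * \<alpha>\<^sup>2)"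
    and W: "W = m * (1 - \<nu>\<^sup>2) / (1 + \<nu>\<^sup>2)"
    and z1: "z = - c * complex_of_real (\<omega> + W)" and z2: "z * c = complex_of_real (\<omega> + W)"
  shows "eigenvalue (linearization m f \<omega> \<epsilon> \<alpha>) z"
proof -
  \<comment> \<open>The decay rate at energy \<open>- W\<close>: the square root of m^2 - W^2,
    expressed through \<open>\<nu>\<close>.\<close>
  define k where "k = 2 * m * \<nu> / (1 + \<nu>\<^sup>2)"
  have den: "1 + \<nu>\<^sup>2 > 0" by (simp add: add_pos_nonneg)
  then have "k > 0" using assms by (simp add: k_def)
  \<comment> \<open>The even and the odd component of the equation D w = - W w,
    respectively.\<close>
  have mW: "m - W = k * \<nu>" "(m + W) * \<nu> = k"
    using den by (simp_all add: W k_def field_simps power2_eq_square)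
  \<comment> \<open>Odd first and even second component. The scale \<open>b\<close> lets
    \<open>w 1\<close> serve as \<open>r\<close> and \<open>w c\<close> as \<open>s\<close>.\<close>
  define P Q :: "complex \<Rightarrow> complex^2"
    where "P = (\<lambda>b. vector [b * complex_of_real \<nu>, 0])" and "Q = (\<lambda>b. vector [0, b])"
  define w where "w = (\<lambda>b. profile k (P b) (Q b))"
  define w' where "w' = (\<lambda>b. profile k (- k *\<^sub>R Q b) (- k *\<^sub>R P b))"
  have dirac: "dirac m (w' b) (w b) x = - W *\<^sub>R w b x" for b x
  proof -
    have cmW: "(complex_of_real m + W) * \<nu> = k" "complex_of_real m = W + k * \<nu>"
      using mW by (metis of_real_add of_real_mult, metis of_real_add of_real_mult add.commute diff_add_cancel)
    define e s where "e = exp (- k * \<bar>x\<bar>)" and "s = sgn x"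
    have "m * (e * s * (b * \<nu>)) - e * s * k * b = - (W * (e * s * (b * \<nu>)))"
      by (simp add: algebra_simps flip: cmW(1))
    moreover have "e * k * (b * \<nu>) - m * (e * b) = - (W * (e * b))"
      by (simp add: algebra_simps cmW(2))
    ultimately show ?thesis
      by (simp add: dirac_def w_def w'_def profile_def P_def Q_def spinor_simps
          scaleR_conv_of_real[where 'a = complex] e_def s_def mult_ac)
  qed
  have wb: "w b x = b *s w 1 x" for b x
    by (simp add: w_def profile_def P_def Q_def vec_eq_iff forall_2 algebra_simps)
  \<comment> \<open>The mean is (0, b), so any coefficient \<open>d\<close> of \<open>Pi1\<close> is
    admissible: one statement serves the conditions on \<open>r\<close> and, with \<open>d\<close> =
    0, on \<open>s\<close>. The second row is b times \<open>jump_cond\<close>, up to sign.\<close>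
  have jump: "\<i> *s (sigma2 *v jump (w b)) = (f ((1 + \<epsilon>) * \<alpha>\<^sup>2) *\<^sub>R (sigma3 + \<epsilon> *\<^sub>R mat 1) + d *\<^sub>R Pi1) *v mean (w b)"
    for b d
  proof -
    have "2 * complex_of_real \<nu> = (1 - \<epsilon>) * f ((1 + \<epsilon>) * \<alpha>\<^sup>2)"
      using jump_cond by (metis of_real_mult of_real_numeral)
    then have "b * (2 * complex_of_real \<nu>) = b * ((1 - \<epsilon>) * f ((1 + \<epsilon>) * \<alpha>\<^sup>2))"
      by (rule arg_cong)
    then show ?thesis
      by (simp add: w_def jump_profile mean_profile P_def Q_def spinor_simps
          scaleR_conv_of_real[where 'a = complex] algebra_simps)
  qed
  have dom: "(w 1, w c) \<in> linearization_domain f \<epsilon> \<alpha>"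
    using jump[of 1] jump[of c 0] \<open>k > 0\<close>
    by (simp add: linearization_domain_def Let_def w_def profile_in_H1)
  have L2: "w b \<in> L2" "w' b \<in> L2" for b
    using \<open>k > 0\<close> by (simp_all add: w_def w'_def profile_in_L2)
  have zw: "(\<lambda>x. z *s w b x) = w (z * b)" for b
    using wb[of b] wb[of "z * b"] by (simp add: fun_eq_iff vector_smult_assoc)
  have eq1: "z *s w 1 x = dirac m (w' c) (w c) x - \<omega> *\<^sub>R w c x" for x
    by (simp add: dirac wb[of c] z1 vec_eq_iff forall_2 scaleR_conv_of_real[where 'a = complex]
        algebra_simps)
  have zwc: "z *s w c x = complex_of_real (\<omega> + W) *s w 1 x" for x
    by (simp add: wb[of c] vector_smult_assoc z2)
  have eq2: "z *s w c x = - dirac m (w' 1) (w 1) x + \<omega> *\<^sub>R w 1 x" for x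
    unfolding zwc
    by (simp add: dirac vec_eq_iff forall_2 scaleR_conv_of_real[where 'a = complex] algebra_simps)
  have weak: "weak_derivative (w b) (w' b)" for b
    unfolding w_def w'_def by (rule weak_derivative_profile)
  have zL2: "(\<lambda>x. z *s w b x) \<in> L2" for b
    by (simp only: zw L2)
  \<comment> \<open>The second component is a bare exponential, nonzero even at 0.\<close>
  have w_nz: "w 1 x \<noteq> 0" for x
    by (auto simp: w_def profile_def P_def Q_def vec_eq_iff forall_2)
  have "((w 1, w c), (\<lambda>x. z *s w 1 x, \<lambda>x. z *s w c x)) \<in> linearization m f \<omega> \<epsilon> \<alpha>"
    unfolding linearization_def mem_Collect_eq prod.case
    by (intro conjI bexI[of _ "w' 1"] bexI[of _ "w' c"] AE_I2 dom zL2 L2 weak eq1 eq2)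
  moreover have "\<not> (AE x in lborel. w 1 x = 0 \<and> w c x = 0)"
    using w_nz by (simp add: AE_iff_measurable[OF _ refl])
  ultimately show ?thesis
    unfolding eigenvalue_def by blast
qed

text \<open>\<open>\<omega>\<^sub>1\<close> and \<open>V\<close> delimit the parameters for which
  the amplitude \<open>\<alpha>\<close> is given. The condition that
  \<open>2 * \<omega> + \<zeta> \<epsilon>\<close> is nonzero makes the two eigenvalues
  distinct.\<close>

theorem theorem4p1:
  fixes m \<omega>\<^sub>1 :: real and f :: "real \<Rightarrow> real" and \<alpha> :: "real \<Rightarrow> real \<Rightarrow> real" and V :: "real set"
  assumes "m > 0"
    and "continuous_on UNIV f"
    and "f C1_differentiable_on (- {0})"
    and "f 0 = 0"
    and "- m \<le> \<omega>\<^sub>1" and "\<omega>\<^sub>1 < m"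
    and "open V" and "0 \<in> V"
    and "\<And>\<omega> \<epsilon>. \<omega> \<in> {\<omega>\<^sub>1<..<m} \<Longrightarrow> \<epsilon> \<in> V \<Longrightarrow>
           \<alpha> \<omega> \<epsilon> > 0 \<and> 2 * mu m \<omega> = (1 + \<epsilon>) * f ((1 + \<epsilon>) * (\<alpha> \<omega> \<epsilon>)\<^sup>2)"
  shows "\<exists>\<omega>\<^sub>0 U. 0 < \<omega>\<^sub>0 \<and> \<omega>\<^sub>0 < m \<and> \<omega>\<^sub>1 \<le> \<omega>\<^sub>0 \<and> open U \<and> 0 \<in> U \<and> U \<subseteq> V \<and>
           (\<forall>\<omega>\<in>{\<omega>\<^sub>0<..<m}. \<exists>\<zeta> :: real \<Rightarrow> real.
              (\<forall>\<epsilon>\<in>U.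
                 2 * \<omega> + \<zeta> \<epsilon> \<noteq> 0 \<and>
                 eigenvalue (linearization m f \<omega> \<epsilon> (\<alpha> \<omega> \<epsilon>)) (\<i> * complex_of_real (2 * \<omega> + \<zeta> \<epsilon>)) \<and>
                 eigenvalue (linearization m f \<omega> \<epsilon> (\<alpha> \<omega> \<epsilon>)) (- \<i> * complex_of_real (2 * \<omega> + \<zeta> \<epsilon>))) \<and>
              (\<zeta> \<longlongrightarrow> 0) (at 0))"
proof -
  \<comment> \<open>Frequencies above m/2 give mu^2 at most 1/3, while
    \<open>\<omega>\<^sub>1\<close> keeps \<open>\<alpha>\<close> available.\<close>
  define \<omega>\<^sub>0 where "\<omega>\<^sub>0 = max (m / 2) \<omega>\<^sub>1"
  \<comment> \<open>The radius 1/10 bounds the ratio (1 - \<epsilon>)/(1 + \<epsilon>) by 3/2, so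
    \<nu>^2 is at most 9/4 * 1/3 < 1.\<close>
  define U where "U = V \<inter> {-(1/10)<..<1/10}"
  have "\<exists>\<zeta> :: real \<Rightarrow> real.
      (\<forall>\<epsilon>\<in>U. 2 * \<omega> + \<zeta> \<epsilon> \<noteq> 0 \<and>
         eigenvalue (linearization m f \<omega> \<epsilon> (\<alpha> \<omega> \<epsilon>)) (\<i> * complex_of_real (2 * \<omega> + \<zeta> \<epsilon>)) \<and>
         eigenvalue (linearization m f \<omega> \<epsilon> (\<alpha> \<omega> \<epsilon>)) (- \<i> * complex_of_real (2 * \<omega> + \<zeta> \<epsilon>))) \<and>
      (\<zeta> \<longlongrightarrow> 0) (at 0)" if \<omega>: "\<omega> \<in> {\<omega>\<^sub>0<..<m}" for \<omega>
  proof -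
    have \<omega>_bounds: "\<omega>\<^sub>1 < \<omega>" "m / 2 < \<omega>" "\<omega> < m"
      using \<omega> by (auto simp: \<omega>\<^sub>0_def)
    then have "mu m \<omega> > 0" and mu2: "(mu m \<omega>)\<^sup>2 = (m - \<omega>) / (m + \<omega>)"
      using \<open>m > 0\<close> by (simp_all add: mu_def)
    have mu2_le: "(mu m \<omega>)\<^sup>2 \<le> 1 / 3"
      unfolding mu2 using \<omega>_bounds \<open>m > 0\<close> by (simp add: field_simps)
    \<comment> \<open>Eliminating \<open>f\<close> between the amplitude equation and the required
      jump condition forces this value.\<close>
    define \<nu> where "\<nu> = (\<lambda>\<epsilon>. (1 - \<epsilon>) / (1 + \<epsilon>) * mu m \<omega>)"
    define W where "W = (\<lambda>\<epsilon>. m * (1 - (\<nu> \<epsilon>)\<^sup>2) / (1 + (\<nu> \<epsilon>)\<^sup>2))"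
    have "W 0 = \<omega>"
    proof -
      have "1 - (m - \<omega>) / (m + \<omega>) = 2 * \<omega> / (m + \<omega>)" "1 + (m - \<omega>) / (m + \<omega>) = 2 * m / (m + \<omega>)"
        using \<omega>_bounds \<open>m > 0\<close> by (simp_all add: field_simps)
      then show ?thesis
        using \<omega>_bounds \<open>m > 0\<close> by (simp add: W_def \<nu>_def mu2)
    qed
    have pos: "1 + x\<^sup>2 \<noteq> 0" for x :: real
      by (metis power_one sum_power2_eq_zero_iff zero_neq_one)
    \<comment> \<open>\<open>W\<close> depends on \<epsilon> only through \<open>\<nu>\<close>,
      which is rational in \<epsilon> with no pole at 0.\<close>
    have "isCont W 0"
      unfolding W_def \<nu>_def by (intro continuous_intros) (use pos in auto)
    then have "(W \<longlongrightarrow> \<omega>) (at 0)"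
      using \<open>W 0 = \<omega>\<close> by (simp add: isCont_def)
    then have lim: "((\<lambda>\<epsilon>. W \<epsilon> - \<omega>) \<longlongrightarrow> 0) (at 0)"
      using tendsto_diff[OF _ tendsto_const, of W \<omega> "at 0" \<omega>] by simp
    have "2 * \<omega> + (W \<epsilon> - \<omega>) \<noteq> 0 \<and>
         eigenvalue (linearization m f \<omega> \<epsilon> (\<alpha> \<omega> \<epsilon>)) (\<i> * complex_of_real (2 * \<omega> + (W \<epsilon> - \<omega>))) \<and>
         eigenvalue (linearization m f \<omega> \<epsilon> (\<alpha> \<omega> \<epsilon>)) (- \<i> * complex_of_real (2 * \<omega> + (W \<epsilon> - \<omega>)))"
      if \<epsilon>: "\<epsilon> \<in> U" for \<epsilon>
    proof -
      have \<epsilon>_bounds: "\<epsilon> \<in> V" "- (1/10) < \<epsilon>" "\<epsilon> < 1/10"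
        using \<epsilon> by (auto simp: U_def)
      have q: "0 < (1 - \<epsilon>) / (1 + \<epsilon>)" "(1 - \<epsilon>) / (1 + \<epsilon>) \<le> 3 / 2"
        using \<epsilon>_bounds by (simp_all add: field_simps)
      have "\<nu> \<epsilon> > 0"
        unfolding \<nu>_def using q(1) \<open>mu m \<omega> > 0\<close> by (rule mult_pos_pos)
      have "((1 - \<epsilon>) / (1 + \<epsilon>))\<^sup>2 \<le> (3 / 2)\<^sup>2"
        using q by (intro power_mono) auto
      then have "(\<nu> \<epsilon>)\<^sup>2 \<le> (3 / 2)\<^sup>2 * (1 / 3)"
        unfolding \<nu>_def power_mult_distrib using mu2_le by (intro mult_mono) auto
      then have "(\<nu> \<epsilon>)\<^sup>2 \<le> 1"
        by (simp add: power2_eq_square)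
      \<comment> \<open>Together with \<omega> > 0 this gives \<omega> + W > 0, the nonvanishing of
        2 \<omega> + \<zeta>.\<close>
      then have "W \<epsilon> \<ge> 0"
        using \<open>m > 0\<close> by (simp add: W_def)
      have jump_cond: "2 * \<nu> \<epsilon> = (1 - \<epsilon>) * f ((1 + \<epsilon>) * (\<alpha> \<omega> \<epsilon>)\<^sup>2)"
        using assms(9)[of \<omega> \<epsilon>] \<omega>_bounds \<epsilon>_bounds by (simp add: \<nu>_def field_simps)
      have "eigenvalue (linearization m f \<omega> \<epsilon> (\<alpha> \<omega> \<epsilon>)) z"
        if "z = - c * complex_of_real (\<omega> + W \<epsilon>)" "z * c = complex_of_real (\<omega> + W \<epsilon>)" for z c
        by (rule linearization_eigenvalue[where f = f, OF \<open>m > 0\<close> \<open>\<nu> \<epsilon> > 0\<close> jump_cond W_def[THEN fun_cong] that])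
      \<comment> \<open>The choice c = -i yields the eigenvalue i(\<omega> + W), and c = i its
        negative.\<close>
      from this[of _ "- \<i>"] this[of _ \<i>] show ?thesis
        using \<open>W \<epsilon> \<ge> 0\<close> \<omega>_bounds \<open>m > 0\<close> by (simp add: algebra_simps)
    qed
    with lim show ?thesis
      by (intro exI[of _ "\<lambda>\<epsilon>. W \<epsilon> - \<omega>"]) blast
  qed
  moreover have "0 < \<omega>\<^sub>0" "\<omega>\<^sub>0 < m" "\<omega>\<^sub>1 \<le> \<omega>\<^sub>0" "open U" "0 \<in> U" "U \<subseteq> V"
    using assms by (auto simp: \<omega>\<^sub>0_def U_def)
  ultimately show ?thesis
    by blast
qed

end
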